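(* Let $G$ be a finite group. Then the following are equivalent: (1) $\mathcal{RP}^*(G)$ is a tree; (2) $\mathcal{RP}^*(G)$ is a star; (3) $G\cong\mathbb Z_4$ or $G\cong Q_8$.
   Context: For a group $G$ with identity $e$, the reduced power graph $\mathcal{RP}(G)$ is the simple graph with vertex set $G$ in which $u,v$ are adjacent if and only if $\langle v\rangle\subset\langle u\rangle$ or $\langle u\rangle\subset\langle v\rangle$, where $\subset$ means proper inclusion. The proper reduced power graph $\mathcal{RP}^*(G)$ is the subgraph of $\mathcal{RP}(G)$ induced on $G\setminus\{e\}$. $Q_8$ is the quaternion group of order $8$. A tree is a connected acyclic graph and a star is a complete bipartite graph of the form $K_{1,m}$.
   Formalization: The equivalence of (1) and (2) is stated only for groups of order other than 2, since for G of order 2 the graph is a single vertex, a tree, while G is neither Z_4 nor Q_8; a star means K_{1,m} with m ≥ 1, and (2) ⟺ (3) is stated for all finite groups. *)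

theory Defs
  imports
    "HOL-Algebra.Elementary_Groups"
    "HOL-Algebra.Generated_Groups"
    "Graph_Theory.Graph_Theory"
begin

text \<open>
  As in \<^theory>\<open>Graph_Theory.Digraph\<close>, an undirected simple graph is a symmetric loop-free digraph
  without parallel arcs: an edge between \<open>u\<close> and \<open>v\<close> is the pair of arcs \<open>(u, v)\<close>, \<open>(v, u)\<close>.
\<close>

definition reduced_power_graph :: "('a, 'b) monoid_scheme \<Rightarrow> ('a, 'a \<times> 'a) pre_digraph" where
  "reduced_power_graph G = with_proj
     \<lparr> pverts = carrier G,
       parcs = {(u, v) \<in> carrier G \<times> carrier G.
                  generate G {v} \<subset> generate G {u} \<or> generate G {u} \<subset> generate G {v}} \<rparr>"

definition proper_reduced_power_graph ::
    "('a, 'b) monoid_scheme \<Rightarrow> ('a, 'a \<times> 'a) pre_digraph" where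
  "proper_reduced_power_graph G = reduced_power_graph G \<restriction> (carrier G - {\<one>\<^bsub>G\<^esub>})"

text \<open>
  The library constants \<^const>\<open>forest\<close> and \<^const>\<open>Digraph_Component.tree\<close> count the closed walk \<open>u, v, u\<close>
  as a cycle, so no symmetric digraph with an arc satisfies them. Cycles of an undirected simple
  graph are those of length at least 3. The library's connectedness excludes the graph
  without vertices, but a single vertex is connected, hence a tree.
\<close>

definition undirected_acyclic :: "('a, 'b) pre_digraph \<Rightarrow> bool" where
  "undirected_acyclic \<Gamma> \<longleftrightarrow> \<not> (\<exists>p. pre_digraph.cycle \<Gamma> p \<and> 3 \<le> length p)"

definition undirected_tree :: "('a, 'b) pre_digraph \<Rightarrow> bool" where
  "undirected_tree \<Gamma> \<longleftrightarrow> graph \<Gamma> \<and> Digraph_Component.connected \<Gamma> \<and> undirected_acyclic \<Gamma>"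

text \<open>Both parts of a complete bipartite graph are nonempty, so a single vertex is not a star.\<close>

definition star :: "('a, 'b) pre_digraph \<Rightarrow> bool" where
  "star \<Gamma> \<longleftrightarrow> (\<exists>m \<ge> 1. complete_bipartite_digraph 1 m \<Gamma>)"

text \<open>
  \<open>(a, b, c, d)\<close> stands for the quaternion \<open>a + b i + c j + d k\<close>; the group consists of
  \<open>1, -1, i, -i, j, -j, k, -k\<close> under Hamilton's multiplication.
\<close>

definition quaternion_group :: "(int \<times> int \<times> int \<times> int) monoid" where
  "quaternion_group =
     \<lparr> carrier = {(1,0,0,0), (-1,0,0,0), (0,1,0,0), (0,-1,0,0),
                  (0,0,1,0), (0,0,-1,0), (0,0,0,1), (0,0,0,-1)},
       monoid.mult = (\<lambda>(a,b,c,d) (a',b',c',d').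
         (a*a' - b*b' - c*c' - d*d',
          a*b' + b*a' + c*d' - d*c',
          a*c' - b*d' + c*a' + d*b',
          a*d' + b*c' - c*b' + d*a')),
       one = (1,0,0,0) \<rparr>"

lemma group_quaternion_group: "group quaternion_group"
proof (rule groupI)
  fix x y z
  show "x \<otimes>\<^bsub>quaternion_group\<^esub> y \<otimes>\<^bsub>quaternion_group\<^esub> z
          = x \<otimes>\<^bsub>quaternion_group\<^esub> (y \<otimes>\<^bsub>quaternion_group\<^esub> z)"
    by (cases x, cases y, cases z) (simp add: quaternion_group_def algebra_simps)
next
  fix x y assume "x \<in> carrier quaternion_group" "y \<in> carrier quaternion_group"
  then show "x \<otimes>\<^bsub>quaternion_group\<^esub> y \<in> carrier quaternion_group"
    by (simp add: quaternion_group_def) (elim disjE; simp)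
next
  fix x assume x: "x \<in> carrier quaternion_group"
  then show "\<one>\<^bsub>quaternion_group\<^esub> \<otimes>\<^bsub>quaternion_group\<^esub> x = x"
    by (simp add: quaternion_group_def)
  from x show "\<exists>y\<in>carrier quaternion_group. y \<otimes>\<^bsub>quaternion_group\<^esub> x = \<one>\<^bsub>quaternion_group\<^esub>"
    by (simp add: quaternion_group_def) (elim disjE; simp)
qed (simp add: quaternion_group_def)

lemma order_quaternion_group: "order quaternion_group = 8"
  by (simp add: quaternion_group_def order_def)

text \<open>
  For a group of order 2 the proper reduced power graph is a single vertex: a tree, but not a star
  \<open>K\<^sub>1\<^sub>,\<^sub>m\<close> with \<open>m \<ge> 1\<close>. This group must therefore be excluded when trees are equated with stars.
\<close>

lemma undirected_tree_order_2:
  assumes "group G" and "order G = 2"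
  shows "undirected_tree (proper_reduced_power_graph G)"
proof -
  interpret group G by fact
  have "finite (carrier G)" using assms(2) by (metis card.infinite order_def zero_neq_numeral)
  then have "card (carrier G - {\<one>\<^bsub>G\<^esub>}) = 1" using assms(2) by (simp add: order_def)
  then obtain a where a: "carrier G - {\<one>\<^bsub>G\<^esub>} = {a}" by (rule card_1_singletonE)
  let ?P = "proper_reduced_power_graph G"
  have vs: "verts ?P = {a}" and as: "arcs ?P = {}"
    using a by (auto simp: proper_reduced_power_graph_def reduced_power_graph_def
        induce_subgraph_def)
  have g: "graph ?P"
    by unfold_locales (auto simp: vs as symmetric_def arcs_ends_def sym_def)
  interpret graph ?P by (rule g)
  have "Digraph_Component.connected ?P"
    unfolding Digraph_Component.connected_def strongly_connected_def
    by (auto simp: vs mk_symmetric_def reachable_def rtrancl_on_refl)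
  moreover have "undirected_acyclic ?P"
    by (auto simp: undirected_acyclic_def cycle_def awalk_def as)
  ultimately show ?thesis using g by (simp add: undirected_tree_def)
qed

end

theory Submission
  imports Defs
begin

text \<open>
  All three conditions (the first one for order other than 2) are equivalent to the following: there
  is an involution \<open>z\<close> to which every element other than \<open>1\<close> and \<open>z\<close> squares, and such elements exist.
  The locale \<open>square_centred_group\<close> expresses this.

  Suppose the graph is a tree and \<open>1 \<noteq> \<langle>x\<rangle> \<subset> \<langle>y\<rangle>\<close>. Then \<open>y \<noteq> y\<inverse>\<close>, so \<open>x, y, x\<inverse>, y\<inverse>\<close> would be a
  4-cycle if \<open>x\<close> were not an involution (\<open>square_eq_one_below\<close>). Hence every nontrivial element that
  generates a proper subgroup of \<open>\<langle>y\<rangle>\<close> is an involution, which forces \<open>y\<close> to have order 4 and \<open>x = y\<^sup>2\<close> (\<open>square_above\<close>). So every edge joins an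
  element of order 4 to its square. The map that fixes the involutions and squares every other element
  is constant along edges, and therefore constant, because the graph is connected; its value is \<open>z\<close>
  (\<open>square_centred_group_if_tree\<close>).

  Conversely, in such a group the cyclic subgroups are explicit, \<open>\<langle>z\<rangle> = {1, z}\<close> and
  \<open>\<langle>x\<rangle> = {1, x, z, x\<inverse>}\<close>, and the graph is a star with centre \<open>z\<close>; every star is a tree.

  For the classification, let \<open>a\<^sup>2 = z\<close>. If \<open>a\<close> does not generate the group, choose \<open>b\<close> outside \<open>\<langle>a\<rangle>\<close>.
  Independent square roots of \<open>z\<close> anticommute (\<open>roots_anticommute\<close>), so \<open>a\<close> and \<open>b\<close> satisfy the relations
  of the quaternions \<open>i\<close> and \<open>j\<close>. An element outside \<open>{\<plusminus>1, \<plusminus>a, \<plusminus>b, \<plusminus>ab}\<close>, where \<open>-\<close> is multiplication by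
  \<open>z\<close>, would anticommute with \<open>a\<close>, \<open>b\<close> and \<open>ab\<close>, which is absurd.
\<close>

section \<open>Stars and trees\<close>

lemma star_imp_undirected_tree:
  assumes "star \<Gamma>"
  shows "undirected_tree \<Gamma>"
proof -
  obtain m U V where "m \<ge> 1" and g: "graph \<Gamma>" and UV: "verts \<Gamma> = U \<union> V" "U \<inter> V = {}"
    "card U = 1" "card V = m" "arcs_ends \<Gamma> = U \<times> V \<union> V \<times> U"
    using assms by (auto simp: star_def complete_bipartite_digraph_def)
  then obtain c where U: "U = {c}" by (auto simp: card_1_singleton_iff)
  have vs: "verts \<Gamma> = insert c V" and es: "arcs_ends \<Gamma> = {c} \<times> V \<union> V \<times> {c}" and c: "c \<notin> V"
    using UV U by auto
  interpret graph \<Gamma> by (rule g)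
  have to_c: "u \<rightarrow>\<^sup>*\<^bsub>\<Gamma>\<^esub> c" and from_c: "c \<rightarrow>\<^sup>*\<^bsub>\<Gamma>\<^esub> u" if "u \<in> verts \<Gamma>" for u
  proof -
    have "u = c \<or> u \<rightarrow>\<^bsub>\<Gamma>\<^esub> c" "u = c \<or> c \<rightarrow>\<^bsub>\<Gamma>\<^esub> u" using that es vs by blast+
    then show "u \<rightarrow>\<^sup>*\<^bsub>\<Gamma>\<^esub> c" "c \<rightarrow>\<^sup>*\<^bsub>\<Gamma>\<^esub> u" using that by (metis reachable_refl reachable_adjI)+
  qed
  have "Digraph_Component.connected \<Gamma>"
  proof (rule connectedI)
    show "verts \<Gamma> \<noteq> {}" using vs by simp
    fix u v assume "u \<in> verts \<Gamma>" "v \<in> verts \<Gamma>"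
    then have "u \<rightarrow>\<^sup>*\<^bsub>\<Gamma>\<^esub> v" using to_c from_c reachable_trans by blast
    then show "u \<rightarrow>\<^sup>*\<^bsub>mk_symmetric \<Gamma>\<^esub> v" by (rule reachable_mk_symmetricI)
  qed
  moreover have "undirected_acyclic \<Gamma>"
    unfolding undirected_acyclic_def
  proof
    assume "\<exists>p. cycle p \<and> 3 \<le> length p"
    then obtain u p where p: "awalk u p u" "distinct (tl (awalk_verts u p))" "3 \<le> length p"
      by (auto simp: cycle_def)
    then obtain e1 e2 e3 es where p_eq: "p = e1 # e2 # e3 # es"
      by (auto simp: numeral_3_eq_3 Suc_le_length_iff)
    let ?W = "set (awalk_verts (head \<Gamma> e3) es)"
    have arcs: "e1 \<in> arcs \<Gamma>" "e2 \<in> arcs \<Gamma>" "e3 \<in> arcs \<Gamma>"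
      and t: "tail \<Gamma> e1 = u" "head \<Gamma> e1 = tail \<Gamma> e2" "head \<Gamma> e2 = tail \<Gamma> e3"
      and w: "awalk (head \<Gamma> e3) es u"
      using p(1) by (auto simp: p_eq awalk_Cons_iff)
    have "last (awalk_verts (head \<Gamma> e3) es) = u" "hd (awalk_verts (head \<Gamma> e3) es) = head \<Gamma> e3"
      using w by simp_all
    then have "u \<in> ?W" "head \<Gamma> e3 \<in> ?W"
      using last_in_set[OF awalk_verts_non_Nil, of "head \<Gamma> e3" es]
        hd_in_set[OF awalk_verts_non_Nil, of "head \<Gamma> e3" es] by simp_all
    then have "u \<noteq> tail \<Gamma> e3" "head \<Gamma> e3 \<noteq> tail \<Gamma> e2" "tail \<Gamma> e2 \<noteq> tail \<Gamma> e3"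
      using p(2) by (auto simp: p_eq)
    \<comment> \<open>The second arc contains the centre, but then the first or the third arc avoids it.\<close>
    moreover have "x = c \<longleftrightarrow> y \<noteq> c" if "(x, y) \<in> arcs_ends \<Gamma>" for x y
      using that es c by auto
    moreover have "(u, tail \<Gamma> e2) \<in> arcs_ends \<Gamma>" "(tail \<Gamma> e2, tail \<Gamma> e3) \<in> arcs_ends \<Gamma>"
      "(tail \<Gamma> e3, head \<Gamma> e3) \<in> arcs_ends \<Gamma>"
      using arcs[THEN in_arcs_imp_in_arcs_ends] t by simp_all
    ultimately show False by metis
  qed
  ultimately show ?thesis using g by (simp add: undirected_tree_def)
qed

lemma card_verts_star:
  assumes "star \<Gamma>"
  shows "card (verts \<Gamma>) \<ge> 2"
proof -
  obtain m U V where "m \<ge> 1" and UV: "verts \<Gamma> = U \<union> V" "U \<inter> V = {}" "card U = 1" "card V = m"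
    using assms by (force simp: star_def complete_bipartite_digraph_def)
  then have "finite U" "finite V" by (auto intro: card_ge_0_finite)
  then show ?thesis using UV \<open>m \<ge> 1\<close> by (simp add: card_Un_disjoint)
qed

section \<open>Reduced power graphs\<close>

lemma verts_proper_reduced_power_graph:
  "verts (proper_reduced_power_graph G) = carrier G - {\<one>\<^bsub>G\<^esub>}"
  by (simp add: proper_reduced_power_graph_def)

lemma arcs_proper_reduced_power_graph:
  "arcs (proper_reduced_power_graph G) =
    {(u, v). u \<in> carrier G - {\<one>\<^bsub>G\<^esub>} \<and> v \<in> carrier G - {\<one>\<^bsub>G\<^esub>} \<and>
       (generate G {v} \<subset> generate G {u} \<or> generate G {u} \<subset> generate G {v})}"
  by (auto simp: proper_reduced_power_graph_def reduced_power_graph_def)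

lemma ends_proper_reduced_power_graph:
  "tail (proper_reduced_power_graph G) = fst" "head (proper_reduced_power_graph G) = snd"
  by (simp_all add: proper_reduced_power_graph_def reduced_power_graph_def)

lemma arcs_ends_proper_reduced_power_graph:
  "arcs_ends (proper_reduced_power_graph G) = arcs (proper_reduced_power_graph G)"
  by (simp add: arcs_ends_conv ends_proper_reduced_power_graph)

lemmas proper_reduced_power_graph_simps =
  verts_proper_reduced_power_graph arcs_proper_reduced_power_graph
  ends_proper_reduced_power_graph arcs_ends_proper_reduced_power_graph

lemma graph_proper_reduced_power_graph:
  assumes "finite (carrier G)"
  shows "graph (proper_reduced_power_graph G)"
proof -
  have "arcs (proper_reduced_power_graph G) \<subseteq> carrier G \<times> carrier G"
    by (auto simp: proper_reduced_power_graph_simps)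
  then have "finite (arcs (proper_reduced_power_graph G))"
    using assms by (meson finite_SigmaI finite_subset)
  then show ?thesis
    using assms
    by unfold_locales
      (auto simp: proper_reduced_power_graph_simps symmetric_def sym_def arc_to_ends_def)
qed

context group
begin

lemma generate_singleton_inv:
  assumes "x \<in> carrier G"
  shows "generate G {inv x} = generate G {x}"
proof
  show "generate G {inv x} \<subseteq> generate G {x}"
    using assms by (intro generate_subgroup_incl generate_is_subgroup) (auto intro: generate.inv)
  have "inv (inv x) \<in> generate G {inv x}" by (rule generate.inv) simp
  then show "generate G {x} \<subseteq> generate G {inv x}"
    using assms by (intro generate_subgroup_incl generate_is_subgroup) auto
qed

lemma generate_singleton_subset:
  assumes "x \<in> generate G {y}" "y \<in> carrier G"
  shows "generate G {x} \<subseteq> generate G {y}"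
  using assms by (intro generate_subgroup_incl generate_is_subgroup) auto

text \<open>
  This covers every element whose order divides 4; the listed elements need not be distinct.
\<close>
lemma generate_singleton_order_dvd_4:
  assumes y: "y \<in> carrier G" and p: "y \<otimes> y = p" "p \<otimes> p = \<one>"
  shows "generate G {y} = {\<one>, y, p, p \<otimes> y}" and "inv y = p \<otimes> y"
proof -
  have pc: "p \<in> carrier G" using y p(1) by auto
  have yp: "y \<otimes> p = p \<otimes> y" using y by (simp add: p(1)[symmetric] m_assoc)
  have rules: "y \<otimes> (y \<otimes> w) = p \<otimes> w" "y \<otimes> (p \<otimes> w) = p \<otimes> (y \<otimes> w)" "p \<otimes> (p \<otimes> w) = w"
    if "w \<in> carrier G" for w
    using that y pc p yp by (simp_all add: m_assoc[symmetric])
  note rules = rules p yp m_assoc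
  show inv_y: "inv y = p \<otimes> y"
    using y pc by (intro inv_equality) (simp_all add: rules)
  have "x \<in> {\<one>, y, p, p \<otimes> y}" if "x \<in> generate G {y}" for x
    using that
  proof induction
    case (eng h1 h2)
    then show ?case using y pc by (elim insertE emptyE) (simp_all add: rules)
  qed (simp_all add: inv_y)
  moreover have "{\<one>, y, p, p \<otimes> y} \<subseteq> generate G {y}"
    using generate.one[of G "{y}"] generate.incl[of y "{y}" G] generate.inv[of y "{y}" G]
      generate.eng[of y G "{y}" y] by (simp add: inv_y p)
  ultimately show "generate G {y} = {\<one>, y, p, p \<otimes> y}" by blast
qed

text \<open>
  Since \<open>\<langle>x\<inverse>\<rangle> = \<langle>x\<rangle>\<close> and \<open>\<langle>y\<inverse>\<rangle> = \<langle>y\<rangle>\<close>, the closed walk \<open>x, y, x\<inverse>, y\<inverse>, x\<close> follows edges. It is a cycle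
  unless \<open>x = x\<inverse>\<close>, because \<open>y = y\<inverse>\<close> would leave no proper nontrivial subgroup in \<open>\<langle>y\<rangle>\<close>.
\<close>
lemma square_eq_one_below:
  assumes acyclic: "undirected_acyclic (proper_reduced_power_graph G)"
    and x: "x \<in> carrier G" "x \<noteq> \<one>" and y: "y \<in> carrier G"
    and less: "generate G {x} \<subset> generate G {y}"
  shows "x \<otimes> x = \<one>"
proof (rule ccontr)
  let ?P = "proper_reduced_power_graph G"
  interpret P: pre_digraph ?P .
  assume "x \<otimes> x \<noteq> \<one>"
  then have x_inv: "x \<noteq> inv x" using x by (metis r_inv)
  have y1: "y \<noteq> \<one>" using less generate_one generate.one[of G "{x}"] by auto
  have x_in: "x \<in> generate G {y}" using less generate.incl[of x "{x}" G] by auto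
  have y_inv: "y \<noteq> inv y"
  proof
    assume "y = inv y"
    then have "y \<otimes> y = \<one>" using y by (metis r_inv)
    then have "generate G {y} = {\<one>, y}"
      using generate_singleton_order_dvd_4(1)[of y \<one>] y by auto
    then show False using x_in x(2) less by auto
  qed
  have gens: "generate G {inv x} = generate G {x}" "generate G {inv y} = generate G {y}"
    using x y generate_singleton_inv by auto
  then have ne: "x \<noteq> y" "x \<noteq> inv y" "inv x \<noteq> y" "inv x \<noteq> inv y" using less by auto
  have inv1: "inv x \<noteq> \<one>" "inv y \<noteq> \<one>" using x y y1 by auto
  have "P.awalk x [(x, y), (y, inv x), (inv x, inv y), (inv y, x)] x"
    using x y y1 inv1 less gens
    by (auto simp: P.awalk_def proper_reduced_power_graph_simps)
  moreover have "distinct (tl (P.awalk_verts x [(x, y), (y, inv x), (inv x, inv y), (inv y, x)]))"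
    using ne x_inv y_inv by (auto simp: proper_reduced_power_graph_simps)
  ultimately have "P.cycle [(x, y), (y, inv x), (inv x, inv y), (inv y, x)]"
    unfolding P.cycle_def by blast
  then show False using acyclic unfolding undirected_acyclic_def by fastforce
qed

lemma square_above:
  assumes acyclic: "undirected_acyclic (proper_reduced_power_graph G)"
    and x: "x \<in> carrier G" "x \<noteq> \<one>" and y: "y \<in> carrier G"
    and less: "generate G {x} \<subset> generate G {y}"
  shows "y \<otimes> y = x"
proof -
  have xx: "x \<otimes> x = \<one>" by (rule square_eq_one_below[OF assms])
  have x_in: "x \<in> generate G {y}" using less generate.incl[of x "{x}" G] by auto
  have yy_in: "y \<otimes> y \<in> generate G {y}" by (intro generate.eng generate.incl) auto
  have yy: "y \<otimes> y \<noteq> \<one>"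
  proof
    assume "y \<otimes> y = \<one>"
    then have "generate G {y} = {\<one>, y}"
      using generate_singleton_order_dvd_4(1)[of y \<one>] y by auto
    then show False using x_in x(2) less by auto
  qed
  have "y \<notin> generate G {y \<otimes> y}"
  \<comment> \<open>Otherwise \<open>y = y\<^sup>2\<^sup>k\<close> for some \<open>k\<close>, hence \<open>x = x\<^sup>2\<^sup>k = 1\<close>.\<close>
  proof
    assume "y \<in> generate G {y \<otimes> y}"
    then obtain k :: int where k: "y = (y \<otimes> y) [^] k" using generate_pow y by auto
    obtain m :: int where m: "x = y [^] m" using x_in generate_pow y by auto
    have sq: "y \<otimes> y = y [^] (2::int)" using y int_pow_mult[of y 1 1] by simp
    have "x = y [^] (2 * k * m)" using k m y by (metis sq int_pow_pow)
    also have "\<dots> = (y [^] (2 * m)) [^] k" using y by (simp add: int_pow_pow algebra_simps)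
    also have "y [^] (2 * m) = \<one>" using xx y by (metis m int_pow_mult mult_2)
    also have "\<one> [^] k = \<one>" by simp
    finally show False using x(2) by simp
  qed
  \<comment> \<open>So \<open>y\<^sup>2\<close> also lies strictly below \<open>y\<close> and is an involution.\<close>
  then have "generate G {y \<otimes> y} \<subset> generate G {y}"
    using generate_singleton_subset[OF yy_in y] generate.incl[of y "{y}" G] by auto
  then have p4: "(y \<otimes> y) \<otimes> (y \<otimes> y) = \<one>"
    using square_eq_one_below[OF acyclic] y yy by blast
  note cyc = generate_singleton_order_dvd_4[OF y refl p4]
  have "x \<noteq> y" "x \<noteq> inv y" using less generate_singleton_inv y by auto
  then show ?thesis using x_in x(2) unfolding cyc by auto
qed

end

section \<open>Groups in which all but two elements square to the same involution\<close>

text \<open>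
  Every nontrivial element other than the involution \<open>z\<close> squares to \<open>z\<close>. The last assumption excludes
  only the group of order 2.
\<close>
locale square_centred_group = group G for G (structure) +
  fixes z
  assumes z_closed [simp, intro]: "z \<in> carrier G"
    and z_neq_one: "z \<noteq> \<one>"
    and z_square: "z \<otimes> z = \<one>"
    and square_eq: "x \<in> carrier G \<Longrightarrow> x \<noteq> \<one> \<Longrightarrow> x \<noteq> z \<Longrightarrow> x \<otimes> x = z"
    and ex_root: "\<exists>x\<in>carrier G. x \<otimes> x = z"

lemma (in group) square_centred_group_if_tree:
  assumes tree: "undirected_tree (proper_reduced_power_graph G)" and order: "order G \<noteq> 2"
  shows "\<exists>z. square_centred_group G z"
proof -
  let ?P = "proper_reduced_power_graph G"
  interpret P: graph ?P using tree by (simp add: undirected_tree_def)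
  have acyclic: "undirected_acyclic ?P" using tree by (simp add: undirected_tree_def)
  have reach: "u \<rightarrow>\<^sup>*\<^bsub>?P\<^esub> v" if "u \<in> carrier G - {\<one>}" "v \<in> carrier G - {\<one>}" for u v
    using that tree
    by (auto simp: undirected_tree_def Digraph_Component.connected_def strongly_connected_def
        P.reachable_mk_symmetric_eq[OF P.sym_arcs] verts_proper_reduced_power_graph)
  have below: "x \<otimes> x = \<one>" "y \<otimes> y = x"
    if "x \<in> carrier G - {\<one>}" "y \<in> carrier G - {\<one>}" "generate G {x} \<subset> generate G {y}" for x y
    using that square_eq_one_below[OF acyclic, of x y] square_above[OF acyclic, of x y] by auto
  \<comment> \<open>The involution at the lower end of every edge at \<open>x\<close>, or \<open>x\<close> itself if \<open>x\<close> is an involution.\<close>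
  define s where "s x = (if x \<otimes> x = \<one> then x else x \<otimes> x)" for x
  have s_adj: "s u = s v" if "u \<rightarrow>\<^bsub>?P\<^esub> v" for u v
    using that below[of u v] below[of v u]
    by (auto simp: proper_reduced_power_graph_simps s_def)
  have s_const: "s u = s v" if "u \<rightarrow>\<^sup>*\<^bsub>?P\<^esub> v" for u v
    using that by (induction rule: P.reachable_induct) (auto dest: s_adj)
  have "verts ?P \<noteq> {}"
    using tree by (auto simp: undirected_tree_def Digraph_Component.connected_def
        strongly_connected_def mk_symmetric_def)
  then obtain a where a: "a \<in> carrier G - {\<one>}" by (auto simp: verts_proper_reduced_power_graph)
  obtain b where b: "b \<in> carrier G - {\<one>}" "b \<noteq> a"
  proof -
    have "carrier G \<noteq> {\<one>, a}" using order a by (auto simp: order_def)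
    then show thesis using a that by blast
  qed
  have "\<exists>c. a \<rightarrow>\<^bsub>?P\<^esub> c"
    using reach[OF a b(1)] b(2) by (cases rule: P.converse_reachable_cases) auto
  then obtain x y where x: "x \<in> carrier G - {\<one>}" and y: "y \<in> carrier G - {\<one>}"
    and less: "generate G {x} \<subset> generate G {y}"
    by (auto simp: proper_reduced_power_graph_simps)
  note xy = below[OF x y less]
  have s_x: "s v = x" if "v \<in> carrier G - {\<one>}" for v
    using s_const[OF reach[OF that x]] xy by (simp add: s_def)
  then have "v \<otimes> v = x" if "v \<in> carrier G" "v \<noteq> \<one>" "v \<noteq> x" for v
    using that s_x[of v] unfolding s_def by (metis DiffI empty_iff insert_iff)
  then have "square_centred_group G x"
    using x y xy by unfold_locales auto
  then show ?thesis ..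
qed

context square_centred_group
begin

lemma star_proper_reduced_power_graph:
  assumes finite: "finite (carrier G)"
  shows "star (proper_reduced_power_graph G)"
proof -
  let ?P = "proper_reduced_power_graph G" and ?V = "carrier G - {\<one>, z}"
  have gen_z: "generate G {z} = {\<one>, z}"
    using generate_singleton_order_dvd_4(1)[of z \<one>] z_square by auto
  have gen: "generate G {x} = {\<one>, x, z, inv x}" if "x \<in> ?V" for x
    using generate_singleton_order_dvd_4[of x z] square_eq[of x] z_square that by auto
  have less: "generate G {x} \<subset> generate G {y} \<longleftrightarrow> x = z \<and> y \<noteq> z"
    if x: "x \<in> carrier G - {\<one>}" and y: "y \<in> carrier G - {\<one>}" for x y
  proof (cases "y = z")
    case True
    then show ?thesis
      using x generate.one[of G "{x}"] generate.incl[of x "{x}" G] gen_z by auto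
  next
    case y_z: False
    show ?thesis
    proof (cases "x = z")
      case True
      then show ?thesis using gen[of y] gen_z y y_z by auto
    next
      case False
      then have "x = y \<or> x = inv y" if "x \<in> generate G {y}"
        using that gen[of y] x y y_z by auto
      then have "generate G {x} = generate G {y}" if "x \<in> generate G {y}"
        using that generate_singleton_inv y by auto
      then show ?thesis using False generate.incl[of x "{x}" G] by auto
    qed
  qed
  obtain a where a: "a \<in> carrier G" "a \<otimes> a = z" using ex_root by blast
  then have "a \<in> ?V" using z_square z_neq_one by auto
  moreover have "finite ?V" using finite by simp
  ultimately have card: "card ?V \<ge> 1" by (metis One_nat_def Suc_leI card_gt_0_iff empty_iff)
  have "(u, v) \<in> arcs_ends ?P \<longleftrightarrow> (u, v) \<in> {z} \<times> ?V \<union> ?V \<times> {z}" for u v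
  proof (cases "u \<in> carrier G - {\<one>} \<and> v \<in> carrier G - {\<one>}")
    case True
    then show ?thesis
      using less[of v u] less[of u v] by (simp add: proper_reduced_power_graph_simps) blast
  next
    case False
    then show ?thesis using z_neq_one by (auto simp: proper_reduced_power_graph_simps)
  qed
  then have "arcs_ends ?P = {z} \<times> ?V \<union> ?V \<times> {z}"
    by (simp only: set_eq_iff split_paired_All) blast
  moreover have "verts ?P = {z} \<union> ?V"
    using z_neq_one by (auto simp: verts_proper_reduced_power_graph)
  ultimately have "complete_bipartite_digraph 1 (card ?V) ?P"
    unfolding complete_bipartite_digraph_def
    using graph_proper_reduced_power_graph[OF finite]
    by (intro conjI exI[of _ "{z}"] exI[of _ ?V]) simp_all
  then show ?thesis using card unfolding star_def by blast
qed

lemma z_central: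
  assumes "x \<in> carrier G"
  shows "x \<otimes> z = z \<otimes> x"
proof (cases "x = \<one> \<or> x = z")
  case False
  then have "x \<otimes> x = z" using assms square_eq by blast
  then show ?thesis using assms m_assoc[of x x x] by simp
qed (use assms in auto)

lemma z_cancel: "x \<in> carrier G \<Longrightarrow> z \<otimes> (z \<otimes> x) = x"
  by (simp add: m_assoc[symmetric] z_square)

lemma inv_root:
  assumes "a \<in> carrier G" "a \<otimes> a = z"
  shows "inv a = z \<otimes> a"
  using assms by (intro inv_equality) (simp_all add: m_assoc z_square)

text \<open>
  If \<open>b\<close> lies outside \<open>\<langle>a\<rangle> = {1, z, a, z a}\<close>, then \<open>a b\<close> is neither \<open>1\<close> nor \<open>z\<close>, hence again a square root
  of \<open>z\<close>, with inverse \<open>z (a b)\<close>. On the other hand \<open>(b a) (a b) = 1\<close>.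
\<close>
lemma roots_anticommute:
  assumes a: "a \<in> carrier G" "a \<otimes> a = z" and b: "b \<in> carrier G" "b \<otimes> b = z"
    and indep: "b \<noteq> a" "b \<noteq> z \<otimes> a"
  shows "b \<otimes> a = z \<otimes> (a \<otimes> b)" and "(a \<otimes> b) \<otimes> (a \<otimes> b) = z"
proof -
  have "a \<otimes> b \<noteq> \<one>"
  proof
    assume "a \<otimes> b = \<one>"
    then have "a = z \<otimes> b" using inv_equality[of a b] inv_root[OF b] a b by simp
    then show False using z_cancel[OF b(1)] indep(2) by simp
  qed
  moreover have "a \<otimes> b \<noteq> z" using Units_l_cancel[of a b a] a b indep(1) by (auto simp: Units_eq)
  ultimately show ab: "(a \<otimes> b) \<otimes> (a \<otimes> b) = z" using a b square_eq by blast
  have "(b \<otimes> a) \<otimes> (a \<otimes> b) = b \<otimes> (a \<otimes> a) \<otimes> b"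
    using a(1) b(1) by (simp add: m_assoc)
  also have "\<dots> = \<one>" using a b z_central[of b] by (simp add: m_assoc z_square)
  finally show "b \<otimes> a = z \<otimes> (a \<otimes> b)"
    using a b inv_root[OF _ ab] inv_equality[of "b \<otimes> a" "a \<otimes> b"] by simp
qed

lemma iso_integer_mod_group_4:
  assumes a: "a \<in> carrier G" "a \<otimes> a = z" and G: "carrier G \<subseteq> {\<one>, z, a, z \<otimes> a}"
  shows "G \<cong> integer_mod_group 4"
proof -
  define f :: "int \<Rightarrow> 'a" where
    "f k = (if k = 0 then \<one> else if k = 1 then a else if k = 2 then z else z \<otimes> a)" for k
  have C: "carrier (integer_mod_group 4) = {0, 1, 2, 3}"
    by (auto simp: carrier_integer_mod_group)
  note rules = a(2) z_square z_central[OF a(1)] z_cancel m_assoc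
  have rule: "a \<otimes> (z \<otimes> a) = \<one>" using a inv_root[OF a] r_inv[OF a(1)] by simp
  have "f \<in> hom (integer_mod_group 4) G"
    unfolding hom_def C
    using a(1) by (auto simp: f_def rules rule)
  then interpret f: group_hom "integer_mod_group 4" G f
    by (intro group_hom.intro group_hom_axioms.intro group_integer_mod_group is_group)
  have ne: "a \<noteq> \<one>" "z \<otimes> a \<noteq> \<one>"
    using a z_neq_one z_square rule by auto
  have "f \<in> iso (integer_mod_group 4) G"
    unfolding f.iso_iff C using G ne z_neq_one by (auto simp: f_def)
  then show ?thesis
    using group.iso_sym[OF group_integer_mod_group] is_isoI by blast
qed

lemma iso_quaternion_group:
  assumes a: "a \<in> carrier G" "a \<otimes> a = z" and b: "b \<in> carrier G" "b \<otimes> b = z"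
    and indep: "b \<noteq> a" "b \<noteq> z \<otimes> a"
  shows "G \<cong> quaternion_group"
proof -
  have ba: "b \<otimes> a = z \<otimes> (a \<otimes> b)" and ab: "(a \<otimes> b) \<otimes> (a \<otimes> b) = z"
    using roots_anticommute[OF assms] by auto
  have "x \<in> {\<one>, z, a, z \<otimes> a, b, z \<otimes> b, a \<otimes> b, z \<otimes> (a \<otimes> b)}" if x: "x \<in> carrier G" for x
  \<comment> \<open>A further root \<open>x\<close> would anticommute with \<open>a\<close>, \<open>b\<close> and \<open>a b\<close>, but anticommuting with both \<open>a\<close> and \<open>b\<close>
      makes it commute with \<open>a b\<close>.\<close>
  proof (rule ccontr)
    assume *: "\<not> ?thesis"
    then have xx: "x \<otimes> x = z" using x square_eq by blast
    have xa: "x \<otimes> a = z \<otimes> (a \<otimes> x)" and xb: "x \<otimes> b = z \<otimes> (b \<otimes> x)"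
      and xab: "x \<otimes> (a \<otimes> b) = z \<otimes> (a \<otimes> b \<otimes> x)"
      using roots_anticommute(1)[OF a x xx] roots_anticommute(1)[OF b x xx]
        roots_anticommute(1)[OF m_closed[OF a(1) b(1)] ab x xx] * by blast+
    have "x \<otimes> (a \<otimes> b) = z \<otimes> (a \<otimes> (x \<otimes> b))"
      using a b x by (simp add: xa flip: m_assoc)
    also have "\<dots> = z \<otimes> ((a \<otimes> z) \<otimes> (b \<otimes> x))" using a b x by (simp add: xb m_assoc)
    also have "\<dots> = a \<otimes> b \<otimes> x" using a b x by (simp add: z_central m_assoc z_cancel)
    finally have "z \<otimes> (a \<otimes> b \<otimes> x) = \<one> \<otimes> (a \<otimes> b \<otimes> x)" using xab a b x by simp
    then show False using a b x z_neq_one right_cancel[of "a \<otimes> b \<otimes> x" z \<one>] by blast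
  qed
  then have G: "carrier G \<subseteq> {\<one>, z, a, z \<otimes> a, b, z \<otimes> b, a \<otimes> b, z \<otimes> (a \<otimes> b)}" by blast
  define f :: "int \<times> int \<times> int \<times> int \<Rightarrow> 'a" where
    "f q = (if q = (1,0,0,0) then \<one> else if q = (-1,0,0,0) then z
      else if q = (0,1,0,0) then a else if q = (0,-1,0,0) then z \<otimes> a
      else if q = (0,0,1,0) then b else if q = (0,0,-1,0) then z \<otimes> b
      else if q = (0,0,0,1) then a \<otimes> b else z \<otimes> (a \<otimes> b))" for q
  have rules: "a \<otimes> (a \<otimes> w) = z \<otimes> w" "b \<otimes> (b \<otimes> w) = z \<otimes> w"
    "b \<otimes> (a \<otimes> w) = z \<otimes> (a \<otimes> (b \<otimes> w))"
    "a \<otimes> (z \<otimes> w) = z \<otimes> (a \<otimes> w)" "b \<otimes> (z \<otimes> w) = z \<otimes> (b \<otimes> w)" if "w \<in> carrier G" for w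
    using that a b by (simp_all add: ba z_central flip: m_assoc)
  \<comment> \<open>Rewriting rules to the normal form with \<open>z\<close> first, then \<open>a\<close>, then \<open>b\<close>, each at most once.\<close>
  note rules = rules ba a(2) b(2) z_square z_cancel z_central[OF a(1)] z_central[OF b(1)] m_assoc
  have "f \<in> hom quaternion_group G"
  proof (rule homI)
    fix p q assume "p \<in> carrier quaternion_group" "q \<in> carrier quaternion_group"
    then show "f p \<in> carrier G" "f (p \<otimes>\<^bsub>quaternion_group\<^esub> q) = f p \<otimes> f q"
      using a(1) b(1) unfolding quaternion_group_def
      by (simp; elim disjE; simp add: f_def rules)+
  qed
  then interpret f: group_hom quaternion_group G f
    by (intro group_hom.intro group_hom_axioms.intro group_quaternion_group is_group)
  have inv: "x \<noteq> \<one>" "z \<otimes> x \<noteq> \<one>" if x: "x \<in> carrier G" "x \<otimes> x = z" for x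
  proof -
    show "x \<noteq> \<one>" using x z_neq_one by auto
    then show "z \<otimes> x \<noteq> \<one>" using inv_root[OF x] inv_eq_1_iff[OF x(1)] by simp
  qed
  have "f \<in> iso quaternion_group G"
    unfolding f.iso_iff
  proof
    have "f ` carrier quaternion_group = {\<one>, z, a, z \<otimes> a, b, z \<otimes> b, a \<otimes> b, z \<otimes> (a \<otimes> b)}"
      by (auto simp: quaternion_group_def f_def)
    then show "carrier G \<subseteq> f ` carrier quaternion_group" using G by simp
    show "\<forall>q\<in>carrier quaternion_group. f q = \<one> \<longrightarrow> q = \<one>\<^bsub>quaternion_group\<^esub>"
      using z_neq_one inv[OF a] inv[OF b] inv[OF m_closed[OF a(1) b(1)] ab]
      by (simp add: quaternion_group_def f_def)
  qed
  then show ?thesis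
    using group.iso_sym[OF group_quaternion_group] is_isoI by blast
qed

lemma iso_integer_mod_group_4_or_quaternion_group:
  "G \<cong> integer_mod_group 4 \<or> G \<cong> quaternion_group"
proof -
  obtain a where a: "a \<in> carrier G" "a \<otimes> a = z" using ex_root by blast
  show ?thesis
  proof (cases "carrier G \<subseteq> {\<one>, z, a, z \<otimes> a}")
    case True
    then show ?thesis using iso_integer_mod_group_4[OF a] by blast
  next
    case False
    then obtain b where "b \<in> carrier G" "b \<noteq> \<one>" "b \<noteq> z" "b \<noteq> a" "b \<noteq> z \<otimes> a" by blast
    then show ?thesis using iso_quaternion_group[OF a, of b] square_eq by blast
  qed
qed

end

lemma square_centred_group_iso:
  fixes G (structure)
  assumes H: "square_centred_group H z" and iso: "H \<cong> G" and G: "group G"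
  shows "\<exists>z'. square_centred_group G z'"
proof -
  interpret H: square_centred_group H z by (rule H)
  interpret group G by (rule G)
  obtain h where h: "h \<in> hom H G" "bij_betw h (carrier H) (carrier G)"
    using iso by (auto simp: is_iso_def iso_def)
  interpret h: group_hom H G h using h by unfold_locales
  have inj: "h x = h y \<longleftrightarrow> x = y" if "x \<in> carrier H" "y \<in> carrier H" for x y
    using h(2) that by (auto simp: bij_betw_def inj_on_def)
  have surj: "carrier G = h ` carrier H" using h(2) by (simp add: bij_betw_def)
  have "square_centred_group G (h z)"
  proof
    show "h z \<noteq> \<one>" using inj[of z "\<one>\<^bsub>H\<^esub>"] H.z_neq_one by simp
    show "h z \<otimes> h z = \<one>" using H.z_square by (simp flip: h.hom_mult)
    show "\<exists>x\<in>carrier G. x \<otimes> x = h z"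
      using H.ex_root unfolding surj by (auto simp flip: h.hom_mult)
    fix x assume x: "x \<in> carrier G" "x \<noteq> \<one>" "x \<noteq> h z"
    then obtain y where y: "y \<in> carrier H" "x = h y" unfolding surj by blast
    then have "y \<noteq> \<one>\<^bsub>H\<^esub>" "y \<noteq> z" using x h.hom_one by auto
    then have "y \<otimes>\<^bsub>H\<^esub> y = z" using y H.square_eq by blast
    then show "x \<otimes> x = h z" using y by (simp flip: h.hom_mult)
  qed simp
  then show ?thesis ..
qed

lemma square_centred_group_integer_mod_group_4: "square_centred_group (integer_mod_group 4) 2"
proof -
  interpret group "integer_mod_group 4" by simp
  have C: "carrier (integer_mod_group 4) = {0, 1, 2, 3}"
    by (auto simp: carrier_integer_mod_group)
  show ?thesis by unfold_locales (auto simp: C)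
qed

lemma square_centred_group_quaternion_group: "square_centred_group quaternion_group (-1, 0, 0, 0)"
proof -
  interpret group quaternion_group by (rule group_quaternion_group)
  show ?thesis by unfold_locales (auto simp: quaternion_group_def)
qed

section \<open>Groups whose proper reduced power graph is a tree\<close>

theorem theorem2p5:
  fixes G :: "('a, 'b) monoid_scheme"
  assumes "group G" and "finite (carrier G)"
  shows "(order G \<noteq> 2 \<longrightarrow>
            (undirected_tree (proper_reduced_power_graph G) \<longleftrightarrow> star (proper_reduced_power_graph G)))
       \<and> (star (proper_reduced_power_graph G) \<longleftrightarrow>
            G \<cong> integer_mod_group 4 \<or> G \<cong> quaternion_group)"
proof -
  interpret group G by fact
  let ?P = "proper_reduced_power_graph G"
  have "order G \<noteq> 2" if "star ?P"
  proof
    assume order: "order G = 2"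
    then have "card (verts ?P) = 1"
      by (simp add: order_def verts_proper_reduced_power_graph)
    then show False using card_verts_star[OF that] by simp
  qed
  moreover have "\<exists>z. square_centred_group G z" if "undirected_tree ?P" "order G \<noteq> 2"
    using square_centred_group_if_tree[OF that] .
  moreover have "star ?P" if "square_centred_group G z" for z
    using square_centred_group.star_proper_reduced_power_graph[OF that assms(2)] .
  moreover have "G \<cong> integer_mod_group 4 \<or> G \<cong> quaternion_group \<longleftrightarrow> (\<exists>z. square_centred_group G z)"
  proof
    assume "G \<cong> integer_mod_group 4 \<or> G \<cong> quaternion_group"
    then have "integer_mod_group 4 \<cong> G \<or> quaternion_group \<cong> G"
      using iso_sym[of "integer_mod_group 4"] iso_sym[of quaternion_group] by blast
    then show "\<exists>z. square_centred_group G z"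
      using square_centred_group_iso[OF square_centred_group_integer_mod_group_4 _ assms(1)]
        square_centred_group_iso[OF square_centred_group_quaternion_group _ assms(1)] by blast
  next
    assume "\<exists>z. square_centred_group G z"
    then obtain z where "square_centred_group G z" ..
    then show "G \<cong> integer_mod_group 4 \<or> G \<cong> quaternion_group"
      by (rule square_centred_group.iso_integer_mod_group_4_or_quaternion_group)
  qed
  ultimately show ?thesis using star_imp_undirected_tree by blast
qed

end
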